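(* Let $Q$ be a semisymmetric quasigroup. Then $Z(Q) = N(Q) = N_\lambda(Q) = N_\mu(Q) = N_\rho(Q)$, and if $N(Q)$ is non-empty, then $N(Q)$ (with the operation of $Q$) is an elementary abelian $2$-group.
   Context: A semisymmetric quasigroup is a set $Q$ with a binary operation $\cdot$ satisfying $(x\cdot y)\cdot x = y$ for all $x,y\in Q$. (Such an operation is automatically a quasigroup operation.) Juxtaposition denotes the operation with higher precedence, so $u\cdot xy = u\cdot(x\cdot y)$. The left, middle and right nucleus of a quasigroup $Q$ are $N_\lambda(Q)=\{u\in Q: u\cdot xy = ux\cdot y \text{ for all } x,y\in Q\}$, $N_\mu(Q)=\{u\in Q: x\cdot uy = xu\cdot y \text{ for all } x,y\in Q\}$, $N_\rho(Q)=\{u\in Q: x\cdot yu = xy\cdot u \text{ for all } x,y\in Q\}$. The nucleus is $N(Q)=N_\lambda(Q)\cap N_\mu(Q)\cap N_\rho(Q)$ and the centre is $Z(Q)=N(Q)\cap\{x\in Q: xy=yx \text{ for all } y\in Q\}$. An elementary abelian $2$-group is an abelian group in which every element squares to the identity (the trivial group is included). *)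

theory Defs
  imports "HOL-Algebra.Group"
begin

locale semisymmetric_quasigroup =
  fixes Q :: "'a set" and mult :: "'a \<Rightarrow> 'a \<Rightarrow> 'a"  (infixl "\<cdot>" 70)
  assumes closed: "\<lbrakk>x \<in> Q; y \<in> Q\<rbrakk> \<Longrightarrow> x \<cdot> y \<in> Q"
    and semisymmetric: "\<lbrakk>x \<in> Q; y \<in> Q\<rbrakk> \<Longrightarrow> (x \<cdot> y) \<cdot> x = y"
begin

(* Unique divisibility on both sides, as the word "quasigroup" promises,
   follows from the semisymmetric law alone. *)

lemma semisymmetric': "x \<cdot> (y \<cdot> x) = y" if "x \<in> Q" "y \<in> Q"
  using that closed semisymmetric by metis

lemma unique_left_division: "\<exists>!x. x \<in> Q \<and> a \<cdot> x = b" if "a \<in> Q" "b \<in> Q"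
  using that closed semisymmetric semisymmetric' by metis

lemma unique_right_division: "\<exists>!x. x \<in> Q \<and> x \<cdot> a = b" if "a \<in> Q" "b \<in> Q"
  using that closed semisymmetric semisymmetric' by metis

end

context
  fixes Q :: "'a set" and mult :: "'a \<Rightarrow> 'a \<Rightarrow> 'a"  (infixl "\<cdot>" 70)
begin

definition left_nucleus :: "'a set" where
  "left_nucleus = {u \<in> Q. \<forall>x\<in>Q. \<forall>y\<in>Q. u \<cdot> (x \<cdot> y) = (u \<cdot> x) \<cdot> y}"

definition middle_nucleus :: "'a set" where
  "middle_nucleus = {u \<in> Q. \<forall>x\<in>Q. \<forall>y\<in>Q. x \<cdot> (u \<cdot> y) = (x \<cdot> u) \<cdot> y}"

definition right_nucleus :: "'a set" where
  "right_nucleus = {u \<in> Q. \<forall>x\<in>Q. \<forall>y\<in>Q. x \<cdot> (y \<cdot> u) = (x \<cdot> y) \<cdot> u}"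

definition nucleus :: "'a set" where
  "nucleus = left_nucleus \<inter> middle_nucleus \<inter> right_nucleus"

definition centre :: "'a set" where
  "centre = nucleus \<inter> {x \<in> Q. \<forall>y\<in>Q. x \<cdot> y = y \<cdot> x}"

end

definition elementary_abelian_2_group :: "('a, 'b) monoid_scheme \<Rightarrow> bool" where
  "elementary_abelian_2_group G \<longleftrightarrow>
     comm_group G \<and> (\<forall>x\<in>carrier G. x \<otimes>\<^bsub>G\<^esub> x = \<one>\<^bsub>G\<^esub>)"

end

theory Submission
  imports Defs
begin

text \<open>
  The semisymmetric law says that the translations \<open>L\<^sub>x : y \<mapsto> x \<cdot> y\<close> and \<open>R\<^sub>x : y \<mapsto> y \<cdot> x\<close> are
  mutually inverse. An element \<open>u\<close> lies in the left nucleus iff \<open>L\<^sub>u L\<^sub>x = L\<^bsub>u \<cdot> x\<^esub>\<close> for all \<open>x\<close>, and in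
  the middle nucleus iff \<open>R\<^sub>x R\<^sub>u = R\<^bsub>u \<cdot> x\<^esub>\<close> for all \<open>x\<close>; each identity is the inverse of the other, so
  these two nuclei coincide (\<open>left_nucleus_eq_middle_nucleus\<close>). The opposite operation is again
  semisymmetric and exchanges left and right, whence the right nucleus is the same set too.

  For commutativity, note that \<open>x \<cdot> y = z\<close> is invariant under cyclic shifts of \<open>(x, y, z)\<close>. Rewriting
  the left nuclear law in this way shows that \<open>L\<^sub>u\<close> commutes with every \<open>L\<^sub>y\<close>; the value at \<open>y\<close> is
  all that matters here. Then \<open>y \<cdot> (u \<cdot> y) = u \<cdot> (y \<cdot> y) = (u \<cdot> y) \<cdot> y\<close>, whereas the middle nuclear
  law gives \<open>y \<cdot> (u \<cdot> y) = (y \<cdot> u) \<cdot> y\<close>, and cancelling \<open>y\<close> on the right yields \<open>u \<cdot> y = y \<cdot> u\<close>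
  (\<open>left_nucleus_commutes\<close>).

  A nuclear \<open>u\<close> therefore satisfies \<open>L\<^sub>u = R\<^sub>u = L\<^sub>u\<^sup>-\<^sup>1\<close>, so \<open>u \<cdot> u\<close> acts as the identity from the
  left. It is a nuclear element, hence commutes with everything and is a two-sided identity; the
  semisymmetric law then forces every square to equal it.
\<close>

context semisymmetric_quasigroup
begin

lemma right_cancel: "x = y" if "x \<cdot> z = y \<cdot> z" "x \<in> Q" "y \<in> Q" "z \<in> Q"
proof -
  have "x = z \<cdot> (x \<cdot> z)" by (rule semisymmetric'[symmetric]) fact+
  also have "\<dots> = z \<cdot> (y \<cdot> z)" by (simp only: that(1))
  also have "\<dots> = y" by (rule semisymmetric') fact+
  finally show ?thesis .
qed

text \<open>This duality transfers every fact about the left nucleus to the right nucleus.\<close>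

lemma opposite: "semisymmetric_quasigroup Q (\<lambda>x y. y \<cdot> x)"
  by unfold_locales (simp_all add: closed semisymmetric')

lemma left_nucleus_opposite: "left_nucleus Q (\<lambda>x y. y \<cdot> x) = right_nucleus Q (\<cdot>)"
  by (auto simp: left_nucleus_def right_nucleus_def)

lemma middle_nucleus_opposite: "middle_nucleus Q (\<lambda>x y. y \<cdot> x) = middle_nucleus Q (\<cdot>)"
  by (auto simp: middle_nucleus_def)

text \<open>
  Both inclusions invert a composition of translations: two left translations turn into two right
  translations in the opposite order, and vice versa. In elements, the nuclear law is applied to
  arguments that the semisymmetric law collapses.
\<close>

lemma left_nucleus_eq_middle_nucleus: "left_nucleus Q (\<cdot>) = middle_nucleus Q (\<cdot>)"
proof (intro equalityI subsetI)
  fix u assume "u \<in> left_nucleus Q (\<cdot>)"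
  then have u: "u \<in> Q" and nuc: "\<And>x y. x \<in> Q \<Longrightarrow> y \<in> Q \<Longrightarrow> u \<cdot> (x \<cdot> y) = (u \<cdot> x) \<cdot> y"
    by (auto simp: left_nucleus_def)
  have "z \<cdot> (u \<cdot> x) = (z \<cdot> u) \<cdot> x" if z: "z \<in> Q" and x: "x \<in> Q" for z x
  proof -
    let ?w = "(z \<cdot> u) \<cdot> x"
    have w: "?w \<in> Q" using u z x closed by simp
    have "(u \<cdot> x) \<cdot> ?w = u \<cdot> (x \<cdot> ?w)" using nuc x w by simp
    also have "\<dots> = z" using u z x closed semisymmetric' by simp
    finally have "(u \<cdot> x) \<cdot> ?w = z" .
    then show ?thesis using semisymmetric[of "u \<cdot> x" ?w] u x w closed by simp
  qed
  then show "u \<in> middle_nucleus Q (\<cdot>)" using u by (simp add: middle_nucleus_def)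
next
  fix u assume "u \<in> middle_nucleus Q (\<cdot>)"
  then have u: "u \<in> Q" and nuc: "\<And>x y. x \<in> Q \<Longrightarrow> y \<in> Q \<Longrightarrow> x \<cdot> (u \<cdot> y) = (x \<cdot> u) \<cdot> y"
    by (auto simp: middle_nucleus_def)
  have "u \<cdot> (x \<cdot> z) = (u \<cdot> x) \<cdot> z" if x: "x \<in> Q" and z: "z \<in> Q" for x z
  proof -
    let ?w = "u \<cdot> (x \<cdot> z)"
    have w: "?w \<in> Q" using u z x closed by simp
    have "?w \<cdot> (u \<cdot> x) = (?w \<cdot> u) \<cdot> x" using nuc x w by simp
    also have "\<dots> = z" using u z x closed semisymmetric by simp
    finally have "?w \<cdot> (u \<cdot> x) = z" .
    then show ?thesis using semisymmetric'[of "u \<cdot> x" ?w] u x w closed by simp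
  qed
  then show "u \<in> left_nucleus Q (\<cdot>)" using u by (simp add: left_nucleus_def)
qed

lemma right_nucleus_eq_middle_nucleus: "right_nucleus Q (\<cdot>) = middle_nucleus Q (\<cdot>)"
  using semisymmetric_quasigroup.left_nucleus_eq_middle_nucleus[OF opposite]
  by (simp only: left_nucleus_opposite middle_nucleus_opposite)

lemma nucleus_eq_left_nucleus: "nucleus Q (\<cdot>) = left_nucleus Q (\<cdot>)"
  by (simp add: nucleus_def left_nucleus_eq_middle_nucleus right_nucleus_eq_middle_nucleus)

lemma left_nucleus_commutes:
  assumes "u \<in> left_nucleus Q (\<cdot>)" and y: "y \<in> Q"
  shows "u \<cdot> y = y \<cdot> u"
proof -
  have u: "u \<in> Q" and left: "\<And>x y. x \<in> Q \<Longrightarrow> y \<in> Q \<Longrightarrow> u \<cdot> (x \<cdot> y) = (u \<cdot> x) \<cdot> y"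
    using assms by (auto simp: left_nucleus_def)
  have middle: "\<And>x y. x \<in> Q \<Longrightarrow> y \<in> Q \<Longrightarrow> x \<cdot> (u \<cdot> y) = (x \<cdot> u) \<cdot> y"
    using assms(1) by (auto simp: left_nucleus_eq_middle_nucleus middle_nucleus_def)
  (* The left law is used for the arguments y \<cdot> y and y, whose product is y itself; undoing the
     right multiplication by y then moves y to the left of u \<cdot> y. *)
  have "y \<cdot> (u \<cdot> y) = u \<cdot> (y \<cdot> y)"
  proof -
    have "u \<cdot> y = (u \<cdot> (y \<cdot> y)) \<cdot> y"
      using left[of "y \<cdot> y" y] semisymmetric y closed by simp
    then show ?thesis using semisymmetric'[of y "u \<cdot> (y \<cdot> y)"] u y closed by simp
  qed
  then have "(y \<cdot> u) \<cdot> y = (u \<cdot> y) \<cdot> y" using left middle y by simp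
  then show ?thesis using right_cancel[of "y \<cdot> u" y "u \<cdot> y"] u y closed by simp
qed

lemma centre_eq_nucleus: "centre Q (\<cdot>) = nucleus Q (\<cdot>)"
proof -
  have "nucleus Q (\<cdot>) \<subseteq> {u \<in> Q. \<forall>y\<in>Q. u \<cdot> y = y \<cdot> u}"
  proof
    fix u assume "u \<in> nucleus Q (\<cdot>)"
    then have u: "u \<in> left_nucleus Q (\<cdot>)" by (simp only: nucleus_eq_left_nucleus)
    then have "u \<in> Q" by (simp add: left_nucleus_def)
    then show "u \<in> {u \<in> Q. \<forall>y\<in>Q. u \<cdot> y = y \<cdot> u}"
      by (intro CollectI conjI ballI left_nucleus_commutes[OF u])
  qed
  then show ?thesis unfolding centre_def by (rule Int_absorb2)
qed

lemma left_nucleus_closed: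
  assumes "u \<in> left_nucleus Q (\<cdot>)" "v \<in> left_nucleus Q (\<cdot>)"
  shows "u \<cdot> v \<in> left_nucleus Q (\<cdot>)"
proof -
  have u: "u \<in> Q" and v: "v \<in> Q" using assms by (auto simp: left_nucleus_def)
  have left_u: "u \<cdot> (x \<cdot> y) = (u \<cdot> x) \<cdot> y" if "x \<in> Q" "y \<in> Q" for x y
    using assms that by (auto simp: left_nucleus_def)
  have left_v: "v \<cdot> (x \<cdot> y) = (v \<cdot> x) \<cdot> y" if "x \<in> Q" "y \<in> Q" for x y
    using assms that by (auto simp: left_nucleus_def)
  have "(u \<cdot> v) \<cdot> (x \<cdot> y) = ((u \<cdot> v) \<cdot> x) \<cdot> y" if x: "x \<in> Q" and y: "y \<in> Q" for x y
  proof -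
    have "(u \<cdot> v) \<cdot> (x \<cdot> y) = u \<cdot> (v \<cdot> (x \<cdot> y))" using left_u v x y closed by simp
    also have "\<dots> = (u \<cdot> (v \<cdot> x)) \<cdot> y"
      by (simp only: left_v[OF x y] left_u[OF closed[OF v x] y])
    also have "\<dots> = ((u \<cdot> v) \<cdot> x) \<cdot> y" using left_u v x by simp
    finally show ?thesis .
  qed
  then show ?thesis using u v closed by (simp add: left_nucleus_def)
qed

text \<open>
  Since \<open>u\<close> commutes with \<open>x\<close>, the law \<open>u \<cdot> (x \<cdot> u) = x\<close> reads \<open>u \<cdot> (u \<cdot> x) = x\<close>, and the left
  nuclear law moves the brackets.
\<close>

lemma left_nucleus_square_left_identity:
  assumes "u \<in> left_nucleus Q (\<cdot>)" "x \<in> Q"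
  shows "(u \<cdot> u) \<cdot> x = x"
proof -
  have u: "u \<in> Q" using assms by (simp add: left_nucleus_def)
  have "(u \<cdot> u) \<cdot> x = u \<cdot> (u \<cdot> x)" using assms by (simp add: left_nucleus_def)
  also have "\<dots> = u \<cdot> (x \<cdot> u)" by (simp only: left_nucleus_commutes[OF assms])
  also have "\<dots> = x" using semisymmetric' u assms by simp
  finally show ?thesis .
qed

lemma square_eq_left_identity:
  assumes "e \<in> Q" "x \<in> Q" "e \<cdot> x = x"
  shows "x \<cdot> x = e"
  using assms semisymmetric'[of x e] by simp

lemma nucleus_elementary_abelian_2_group:
  assumes "u \<in> nucleus Q (\<cdot>)"
  shows "elementary_abelian_2_group \<lparr>carrier = nucleus Q (\<cdot>), monoid.mult = (\<cdot>), one = u \<cdot> u\<rparr>"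
    (is "elementary_abelian_2_group ?N")
proof -
  note nuc = nucleus_eq_left_nucleus
  have in_Q: "x \<in> Q" if "x \<in> nucleus Q (\<cdot>)" for x
    using that by (simp add: nuc left_nucleus_def)
  have e: "u \<cdot> u \<in> nucleus Q (\<cdot>)" using assms left_nucleus_closed by (simp add: nuc)
  have id: "(u \<cdot> u) \<cdot> x = x" if "x \<in> Q" for x
    using assms that left_nucleus_square_left_identity by (simp add: nuc)
  have square: "x \<cdot> x = u \<cdot> u" if "x \<in> nucleus Q (\<cdot>)" for x
    using square_eq_left_identity id in_Q e that by simp
  have "comm_group ?N"
  proof (rule comm_groupI)
    fix x y z assume "x \<in> carrier ?N" "y \<in> carrier ?N" "z \<in> carrier ?N"
    then show "x \<otimes>\<^bsub>?N\<^esub> y \<otimes>\<^bsub>?N\<^esub> z = x \<otimes>\<^bsub>?N\<^esub> (y \<otimes>\<^bsub>?N\<^esub> z)"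
      by (simp add: nuc left_nucleus_def)
  next
    fix x assume "x \<in> carrier ?N"
    then show "\<exists>y\<in>carrier ?N. y \<otimes>\<^bsub>?N\<^esub> x = \<one>\<^bsub>?N\<^esub>" using square by auto
  qed (use e id in_Q left_nucleus_commutes left_nucleus_closed in \<open>simp_all add: nuc\<close>)
  then show ?thesis using square by (simp add: elementary_abelian_2_group_def)
qed

end

theorem proposition2p2:
  fixes Q :: "'a set" and f :: "'a \<Rightarrow> 'a \<Rightarrow> 'a"
  assumes "semisymmetric_quasigroup Q f"
  shows "centre Q f = nucleus Q f
       \<and> nucleus Q f = left_nucleus Q f
       \<and> left_nucleus Q f = middle_nucleus Q f
       \<and> middle_nucleus Q f = right_nucleus Q f
       \<and> (nucleus Q f \<noteq> {} \<longrightarrow>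
            (\<exists>e. elementary_abelian_2_group \<lparr>carrier = nucleus Q f, monoid.mult = f, one = e\<rparr>))"
proof -
  interpret semisymmetric_quasigroup Q f by (fact assms)
  show ?thesis
    using centre_eq_nucleus nucleus_eq_left_nucleus left_nucleus_eq_middle_nucleus
      right_nucleus_eq_middle_nucleus nucleus_elementary_abelian_2_group
    by auto
qed

end
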